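(* Suppose $0<\zeta,\xi<\omega_1$. Suppose $f_n:C(\mathcal{T}_{\zeta\xi})\to\mathbb{R}$, $n\in\mathbb{N}$, is a sequence of functions so that (i) for each $c\in C(\mathcal{T}_{\zeta\xi})$ and each $n\in\mathbb{N}$, $f_n(c)\leqslant f_{n+1}(c)$, (ii) for each order preserving $i:\mathcal{T}_\zeta\to\mathcal{T}_{\zeta\xi}$ and each $n\in\mathbb{N}$, $\inf\{f_n(i(c)):c\in C(\mathcal{T}_\zeta)\}=0$. Then for every decreasing sequence $(\varepsilon_n)$ of positive numbers converging to $0$, there exist a regular family $\mathcal{F}$ with $\iota(\mathcal{F})=\xi$ and an order preserving $j:\widehat{\mathcal{F}}\to C(\mathcal{T}_{\zeta\xi})$ so that for all $E\in\widehat{\mathcal{F}}$, $f_{\max E}(j(E))\leqslant\varepsilon_{\max E}$.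
   Context: For finite sequences, $|s|$ is the length of $s$, $s^\frown t$ is concatenation and $s\prec t$ means $s$ is a proper initial segment of $t$. A map $f:P\to Q$ between partially ordered sets is order preserving if $x<_Py$ implies $f(x)<_Qf(y)$ (only this implication); sets of sequences are ordered by $\prec$. Minimal trees: $\mathcal{MT}_0=\{\varnothing\}$, $\mathcal{MT}_{\xi+1}=\{\varnothing\}\cup\{(\xi+1)^\frown t:t\in\mathcal{MT}_\xi\}$, $\mathcal{MT}_\xi=\bigcup_{\zeta<\xi}\mathcal{MT}_{\zeta+1}$ for limit $\xi$, and $\mathcal{T}_\xi=\mathcal{MT}_\xi\setminus\{\varnothing\}$. Segments: for a set $U$ of finite sequences, $C(U)$ is the set of finite, non-empty subsets of $U\setminus\{\varnothing\}$ which are linearly ordered by $\prec$; $c<c'$ means $s\prec t$ for all $s\in c$, $t\in c'$. An order preserving map $i$ induces a map on segments by $i(c)=\{i(t):t\in c\}$. $\zeta\xi$ is the usual ordinal product, so $\zeta(\xi+1)=\zeta\xi+\zeta$. Regular families: finite subsets of $\mathbb{N}$ are identified with strictly increasing finite sequences (hence ordered by $\prec$). $[\mathbb{N}]^{<\omega}$ is the set of finite subsets of $\mathbb{N}$, with the topology inherited from $2^{\mathbb{N}}$. $(k_i)_{i=1}^l$ is a spread of $(j_i)_{i=1}^l$ if $j_i\leqslant k_i$ for all $i$. $\mathcal{F}\subset[\mathbb{N}]^{<\omega}$ is regular if it is compact, spreading (contains all spreads of its members) and hereditary (contains all subsets of its members). $\widehat{\mathcal{F}}=\mathcal{F}\setminus\{\varnothing\}$.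 With $\mathcal{F}'$ the family $\mathcal{F}$ with its $\prec$-maximal members removed, $d^0(\mathcal{F})=\mathcal{F}$, $d^{\xi+1}(\mathcal{F})=(d^\xi(\mathcal{F}))'$, and intersections at limit ordinals, $\iota(\mathcal{F})=\min\{\xi<\omega_1:d^\xi(\mathcal{F})\subset\{\varnothing\}\}$. *)

theory Defs
  imports "HOL-Analysis.Analysis" "HOL-Library.Sublist"
begin

section \<open>Countable ordinals\<close>

text \<open>
  The ordinals below \<open>\<omega>\<^sub>1\<close>, as the elements of the well-ordered set \<open>cardSuc natLeq\<close>
  (the least well-order of uncountable cardinality). An ordinal \<open>\<alpha> < \<omega>\<^sub>1\<close> is the element
  whose set of predecessors has order type \<open>\<alpha>\<close>.
\<close>

typedef cord = "Field (cardSuc natLeq)"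
proof -
  have "infinite (Field (cardSuc natLeq))"
    using cardSuc_finite[OF natLeq_Card_order] by (simp add: Field_natLeq)
  then show "\<exists>x. x \<in> Field (cardSuc natLeq)"
    using infinite_imp_nonempty by blast
qed

lemma cardSuc_natLeq_Well_order: "Well_order (cardSuc natLeq)"
  by (rule card_order_on_well_order_on[OF cardSuc_Card_order[OF natLeq_Card_order]])

instantiation cord :: linorder
begin

definition less_eq_cord :: "cord \<Rightarrow> cord \<Rightarrow> bool"
  where "\<alpha> \<le> \<beta> \<longleftrightarrow> (Rep_cord \<alpha>, Rep_cord \<beta>) \<in> cardSuc natLeq"

definition less_cord :: "cord \<Rightarrow> cord \<Rightarrow> bool"
  where "\<alpha> < \<beta> \<longleftrightarrow> \<alpha> \<le> \<beta> \<and> \<alpha> \<noteq> (\<beta>::cord)"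

instance
proof
  have lin: "Linear_order (cardSuc natLeq)"
    using cardSuc_natLeq_Well_order by (simp add: well_order_on_def)
  then have r: "Refl (cardSuc natLeq)" and t: "trans (cardSuc natLeq)"
    and a: "antisym (cardSuc natLeq)" and tot: "Total (cardSuc natLeq)"
    by (auto simp: order_on_defs)
  fix x y z :: cord
  show refl: "x \<le> x"
    using r Rep_cord[of x] by (simp add: less_eq_cord_def refl_on_def)
  show "x = y" if "x \<le> y" "y \<le> x"
    using antisymD[OF a] that by (metis less_eq_cord_def Rep_cord_inject)
  show "x < y \<longleftrightarrow> x \<le> y \<and> \<not> y \<le> x"
    using antisymD[OF a] refl by (metis less_cord_def less_eq_cord_def Rep_cord_inject)
  show "x \<le> z" if "x \<le> y" "y \<le> z"
    using that transD[OF t] by (metis less_eq_cord_def)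
  show "x \<le> y \<or> y \<le> x"
    using tot Rep_cord[of x] Rep_cord[of y] refl
    by (metis less_eq_cord_def total_on_def Rep_cord_inject)
qed

end

instance cord :: wellorder
proof
  fix P :: "cord \<Rightarrow> bool" and a :: cord
  assume step: "\<And>x. (\<And>y. y < x \<Longrightarrow> P y) \<Longrightarrow> P x"
  have "wf (cardSuc natLeq - Id)"
    using cardSuc_natLeq_Well_order by (simp add: well_order_on_def)
  then have "wf (inv_image (cardSuc natLeq - Id) Rep_cord)"
    by (rule wf_inv_image)
  moreover have "inv_image (cardSuc natLeq - Id) Rep_cord = {(x, y). x < y}"
    by (auto simp: less_cord_def less_eq_cord_def Rep_cord_inject)
  ultimately have "wf {(x::cord, y). x < y}" by simp
  then show "P a"
    by (induction a rule: wf_induct_rule) (use step in auto)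
qed

context includes cardinal_syntax
begin

lemma countable_iff_ordLeq_natLeq: "countable A \<longleftrightarrow> |A| \<le>o natLeq"
proof -
  have "countable A \<longleftrightarrow> |A| \<le>o |UNIV :: nat set|"
    unfolding countable_def using card_of_ordLeq[of A "UNIV :: nat set"] by simp
  then show ?thesis
    using card_of_nat ordLeq_ordIso_trans ordIso_symmetric by blast
qed

lemma uncountable_cord: "uncountable (UNIV :: cord set)"
proof
  assume "countable (UNIV :: cord set)"
  then have "countable (range Rep_cord)" by simp
  then have "countable (Field (cardSuc natLeq))"
    by (simp add: type_definition.Rep_range[OF type_definition_cord])
  then have "|Field (cardSuc natLeq)| \<le>o natLeq"
    by (metis countable_iff_ordLeq_natLeq)
  moreover have "|Field (cardSuc natLeq)| =o cardSuc natLeq"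
    by (rule card_of_Field_ordIso[OF cardSuc_Card_order[OF natLeq_Card_order]])
  ultimately have "cardSuc natLeq \<le>o natLeq"
    using ordIso_symmetric ordIso_ordLeq_trans by blast
  then show False
    using cardSuc_greater[OF natLeq_Card_order] not_ordLess_ordLeq by blast
qed

lemma countable_lessThan_cord: "countable {..<\<alpha>::cord}"
proof -
  have "|underS (cardSuc natLeq) (Rep_cord \<alpha>)| <o cardSuc natLeq"
    by (rule card_of_underS[OF cardSuc_Card_order[OF natLeq_Card_order] Rep_cord])
  then have "|underS (cardSuc natLeq) (Rep_cord \<alpha>)| \<le>o natLeq"
    using cardSuc_ordLeq_ordLess[OF natLeq_Card_order card_of_Card_order] by blast
  then have "countable (underS (cardSuc natLeq) (Rep_cord \<alpha>))"
    by (simp add: countable_iff_ordLeq_natLeq)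
  moreover have "Rep_cord ` {..<\<alpha>} \<subseteq> underS (cardSuc natLeq) (Rep_cord \<alpha>)"
    by (auto simp: underS_def less_cord_def less_eq_cord_def Rep_cord_inject)
  ultimately have "countable (Rep_cord ` {..<\<alpha>})"
    using countable_subset by blast
  then show ?thesis
    by (rule countable_image_inj_on) (simp add: inj_on_def Rep_cord_inject)
qed

end

lemma countable_bounded_cord:
  fixes A :: "cord set"
  assumes "countable A"
  shows "\<exists>u. \<forall>a\<in>A. a < u"
proof (rule ccontr)
  assume no_bound: "\<not> (\<exists>u. \<forall>a\<in>A. a < u)"
  have "x \<in> (\<Union>a\<in>A. {..<a} \<union> {a})" for x
  proof -
    obtain a where "a \<in> A" "\<not> a < x"
      using no_bound by blast
    then show ?thesis
      by (intro UN_I[of a]) (auto simp: not_less le_less)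
  qed
  then have "(\<Union>a\<in>A. {..<a} \<union> {a}) = (UNIV :: cord set)"
    by blast
  moreover have "countable (\<Union>a\<in>A. {..<a} \<union> {a})"
    using assms countable_lessThan_cord by simp
  ultimately show False
    using uncountable_cord by simp
qed

instantiation cord :: zero
begin
definition zero_cord :: cord where "zero_cord = (LEAST \<alpha>. True)"
instance ..
end

lemma zero_le_cord [simp]: "0 \<le> (\<alpha>::cord)"
  unfolding zero_cord_def by (rule Least_le) simp

lemma not_less_zero_cord [simp]: "\<not> (\<alpha>::cord) < 0"
  by (simp add: not_less)

definition osuc :: "cord \<Rightarrow> cord"
  where "osuc \<alpha> = (LEAST \<beta>. \<alpha> < \<beta>)"

definition is_osuc :: "cord \<Rightarrow> bool"
  where "is_osuc \<alpha> \<longleftrightarrow> (\<exists>\<beta>. \<alpha> = osuc \<beta>)"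

definition is_olim :: "cord \<Rightarrow> bool"
  where "is_olim \<alpha> \<longleftrightarrow> \<alpha> \<noteq> 0 \<and> \<not> is_osuc \<alpha>"

definition opred :: "cord \<Rightarrow> cord"
  where "opred \<alpha> = (THE \<beta>. \<alpha> = osuc \<beta>)"

definition osup :: "cord set \<Rightarrow> cord"
  where "osup A = (LEAST u. \<forall>a\<in>A. a \<le> u)"

lemma less_osuc [simp]: "\<alpha> < osuc \<alpha>"
proof -
  have "\<exists>\<beta>. \<alpha> < \<beta>" using countable_bounded_cord[of "{\<alpha>}"] by auto
  then show ?thesis unfolding osuc_def by (metis LeastI_ex)
qed

lemma osuc_le_iff: "osuc \<alpha> \<le> \<beta> \<longleftrightarrow> \<alpha> < \<beta>"
  by (metis less_osuc Least_le order.strict_trans2 osuc_def)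

lemma less_osuc_iff: "\<alpha> < osuc \<beta> \<longleftrightarrow> \<alpha> \<le> \<beta>"
  by (metis not_less osuc_le_iff)

lemma osuc_inject [simp]: "osuc \<alpha> = osuc \<beta> \<longleftrightarrow> \<alpha> = \<beta>"
  by (metis antisym less_osuc less_osuc_iff)

lemma osuc_neq_zero [simp]: "osuc \<alpha> \<noteq> 0"
  by (metis less_osuc not_less_zero_cord)

lemma is_osuc_osuc [simp]: "is_osuc (osuc \<alpha>)"
  by (auto simp: is_osuc_def)

lemma opred_osuc [simp]: "opred (osuc \<alpha>) = \<alpha>"
  by (simp add: opred_def)

lemma opred_less: "is_osuc \<alpha> \<Longrightarrow> opred \<alpha> < \<alpha>"
  by (auto simp: is_osuc_def)

lemma osuc_less_olim: "is_olim \<alpha> \<Longrightarrow> \<beta> < \<alpha> \<Longrightarrow> osuc \<beta> < \<alpha>"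
  by (metis is_olim_def is_osuc_osuc order_le_less osuc_le_iff)

lemma cord_cases [case_names zero osuc olim]:
  obtains "\<alpha> = 0" | \<beta> where "\<alpha> = osuc \<beta>" | "is_olim \<alpha>"
  by (auto simp: is_olim_def is_osuc_def)

lemma is_olim_simps [simp]: "\<not> is_olim 0" "\<not> is_olim (osuc \<alpha>)"
  by (auto simp: is_olim_def)

lemma not_is_osuc_zero [simp]: "\<not> is_osuc 0"
  by (metis is_osuc_def osuc_neq_zero)

lemma is_olimD: "is_olim \<alpha> \<Longrightarrow> \<alpha> \<noteq> 0" "is_olim \<alpha> \<Longrightarrow> \<not> is_osuc \<alpha>"
  by (auto simp: is_olim_def)

function oadd :: "cord \<Rightarrow> cord \<Rightarrow> cord" where
  "oadd \<alpha> \<beta> =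
     (if \<beta> = 0 then \<alpha>
      else if is_osuc \<beta> then osuc (oadd \<alpha> (opred \<beta>))
      else osup ((\<lambda>\<gamma>. oadd \<alpha> \<gamma>) ` {..<\<beta>}))"
  by auto
termination
  by (relation "inv_image {(x, y). x < y} snd") (simp_all add: wf opred_less)

declare oadd.simps [simp del]

instantiation cord :: plus
begin
definition plus_cord :: "cord \<Rightarrow> cord \<Rightarrow> cord" where "plus_cord = oadd"
instance ..
end

lemma add_zero_cord: "\<alpha> + 0 = (\<alpha>::cord)"
  and add_osuc_cord: "\<alpha> + osuc \<beta> = osuc (\<alpha> + \<beta>)"
  and add_olim_cord: "is_olim \<beta> \<Longrightarrow> \<alpha> + \<beta> = osup ((\<lambda>\<gamma>. \<alpha> + \<gamma>) ` {..<\<beta>})"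
  unfolding plus_cord_def by (subst oadd.simps, simp add: is_olimD)+

function omult :: "cord \<Rightarrow> cord \<Rightarrow> cord" where
  "omult \<alpha> \<beta> =
     (if \<beta> = 0 then 0
      else if is_osuc \<beta> then omult \<alpha> (opred \<beta>) + \<alpha>
      else osup ((\<lambda>\<gamma>. omult \<alpha> \<gamma>) ` {..<\<beta>}))"
  by auto
termination
  by (relation "inv_image {(x, y). x < y} snd") (simp_all add: wf opred_less)

declare omult.simps [simp del]

instantiation cord :: times
begin
definition times_cord :: "cord \<Rightarrow> cord \<Rightarrow> cord" where "times_cord = omult"
instance ..
end

lemma mult_zero_cord: "\<alpha> * 0 = (0::cord)"
  and mult_osuc_cord: "\<alpha> * osuc \<beta> = \<alpha> * \<beta> + \<alpha>"
  and mult_olim_cord: "is_olim \<beta> \<Longrightarrow> \<alpha> * \<beta> = osup ((\<lambda>\<gamma>. \<alpha> * \<gamma>) ` {..<\<beta>})"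
  unfolding times_cord_def by (subst omult.simps, simp add: is_olimD)+


section \<open>Order preserving maps, minimal trees and segments\<close>

text \<open>Here \<open>ltP\<close> and \<open>ltQ\<close> are the strict orders of \<open>P\<close> and \<open>Q\<close>.\<close>

definition order_preserving ::
    "('a \<Rightarrow> 'a \<Rightarrow> bool) \<Rightarrow> ('b \<Rightarrow> 'b \<Rightarrow> bool) \<Rightarrow> 'a set \<Rightarrow> 'b set \<Rightarrow> ('a \<Rightarrow> 'b) \<Rightarrow> bool"
  where "order_preserving ltP ltQ P Q f \<longleftrightarrow> f \<in> P \<rightarrow> Q \<and> monotone_on P ltP ltQ f"

text \<open>
  In the successor case \<open>\<xi>\<close> is itself the successor ordinal, so this is the letter to be prepended;
  see the equations \<open>MT_zero\<close>, \<open>MT_osuc\<close>, \<open>MT_olim\<close> below.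
\<close>

function MT :: "cord \<Rightarrow> cord list set" where
  "MT \<xi> =
     (if \<xi> = 0 then {[]}
      else if is_osuc \<xi> then {[]} \<union> (#) \<xi> ` MT (opred \<xi>)
      else (\<Union>\<zeta>\<in>{..<\<xi>}. MT (osuc \<zeta>)))"
  by auto
termination
  by (relation "{(x, y). x < y}") (simp_all add: wf opred_less is_olim_def osuc_less_olim)

declare MT.simps [simp del]

lemma MT_zero: "MT 0 = {[]}"
  and MT_osuc: "MT (osuc \<xi>) = {[]} \<union> (#) (osuc \<xi>) ` MT \<xi>"
  and MT_olim: "is_olim \<xi> \<Longrightarrow> MT \<xi> = (\<Union>\<zeta>\<in>{..<\<xi>}. MT (osuc \<zeta>))"
  by (subst MT.simps, simp add: is_olimD)+

definition \<T> :: "cord \<Rightarrow> cord list set"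
  where "\<T> \<xi> = MT \<xi> - {[]}"

definition segments :: "'a list set \<Rightarrow> 'a list set set"
  where "segments U =
    {c. finite c \<and> c \<noteq> {} \<and> c \<subseteq> U - {[]} \<and>
        (\<forall>s\<in>c. \<forall>t\<in>c. s = t \<or> strict_prefix s t \<or> strict_prefix t s)}"

definition segment_less :: "'a list set \<Rightarrow> 'a list set \<Rightarrow> bool"
  where "segment_less c c' \<longleftrightarrow> (\<forall>s\<in>c. \<forall>t\<in>c'. strict_prefix s t)"


section \<open>Regular families\<close>

text \<open>
  Finite sets of naturals are identified with their increasing enumerations
  (\<open>sorted_list_of_set\<close>). The next two notions are only meant for finite sets, since
  \<open>sorted_list_of_set\<close> maps every infinite set to the empty list.
\<close>

definition fin_less :: "nat set \<Rightarrow> nat set \<Rightarrow> bool"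
  where "fin_less E G \<longleftrightarrow> strict_prefix (sorted_list_of_set E) (sorted_list_of_set G)"

definition is_spread_of :: "nat set \<Rightarrow> nat set \<Rightarrow> bool"
  where "is_spread_of G E \<longleftrightarrow> list_all2 (\<le>) (sorted_list_of_set E) (sorted_list_of_set G)"

text \<open>
  The topology on families is that of \<open>2\<^sup>\<nat>\<close>: a set is viewed through its indicator in
  \<open>nat \<Rightarrow> bool\<close>, which carries the product topology of the discrete topology on \<open>bool\<close>.
\<close>

definition compact_family :: "nat set set \<Rightarrow> bool"
  where "compact_family F \<longleftrightarrow> compact ((\<lambda>E n. n \<in> E) ` F)"

definition spreading :: "nat set set \<Rightarrow> bool"
  where "spreading F \<longleftrightarrow> (\<forall>E\<in>F. \<forall>G. finite G \<and> is_spread_of G E \<longrightarrow> G \<in> F)"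

definition hereditary :: "nat set set \<Rightarrow> bool"
  where "hereditary F \<longleftrightarrow> (\<forall>E\<in>F. \<forall>G. G \<subseteq> E \<longrightarrow> G \<in> F)"

definition regular_family :: "nat set set \<Rightarrow> bool"
  where "regular_family F \<longleftrightarrow>
    (\<forall>E\<in>F. finite E) \<and> compact_family F \<and> spreading F \<and> hereditary F"

definition derived :: "nat set set \<Rightarrow> nat set set"
  where "derived F = F - {E \<in> F. \<not> (\<exists>G\<in>F. fin_less E G)}"

function derived_iter :: "cord \<Rightarrow> nat set set \<Rightarrow> nat set set" where
  "derived_iter \<xi> F =
     (if \<xi> = 0 then F
      else if is_osuc \<xi> then derived (derived_iter (opred \<xi>) F)
      else (\<Inter>\<zeta>\<in>{..<\<xi>}. derived_iter \<zeta> F))"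
  by auto
termination
  by (relation "inv_image {(x, y). x < y} fst") (simp_all add: wf opred_less)

declare derived_iter.simps [simp del]

lemma derived_iter_zero: "derived_iter 0 F = F"
  and derived_iter_osuc: "derived_iter (osuc \<xi>) F = derived (derived_iter \<xi> F)"
  and derived_iter_olim: "is_olim \<xi> \<Longrightarrow> derived_iter \<xi> F = (\<Inter>\<zeta>\<in>{..<\<xi>}. derived_iter \<zeta> F)"
  by (subst derived_iter.simps, simp add: is_olimD)+

text \<open>The minimum exists whenever \<open>F\<close> is a compact family of finite sets.\<close>

definition iota :: "nat set set \<Rightarrow> cord"
  where "iota F = (LEAST \<xi>. derived_iter \<xi> F \<subseteq> {{}})"

end

theory Submission
  imports Defs
begin

text \<open>
  Fix an injection \<open>e\<close> of the ordinals below \<open>\<xi>\<close> into \<open>\<nat>\<close>. Let \<open>F\<close> consist of the finite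
  sets \<open>n\<^sub>1 < \<dots> < n\<^sub>k\<close> that can be labelled by a descending sequence
  \<open>\<xi> > \<alpha>\<^sub>1 > \<dots> > \<alpha>\<^sub>k\<close> with \<open>e \<alpha>\<^sub>i \<le> n\<^sub>i\<close> for all \<open>i\<close>. Raising the \<open>n\<^sub>i\<close> or
  dropping some of them only makes labelling easier, so \<open>F\<close> is spreading and hereditary. Since
  \<open>e\<close> is injective, a nonempty member has finitely many possible last labels; the largest is its
  height, and the empty set gets height \<open>\<xi>\<close>. Restricting a labelling to an initial segment
  shows that heights strictly decrease along \<open>\<prec>\<close> (\<open>height_decreasing\<close>). Hence no infinite set
  has all its finite initial segments in \<open>F\<close>, which makes \<open>F\<close> compact, and \<open>\<iota>(F) \<le> \<xi>\<close>. For
  the other inequality, a labelling with last label \<open>\<alpha>\<close> can be continued by any \<open>\<beta> < \<alpha>\<close> at a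
  sufficiently large integer, so the set stays in \<open>d\<^sup>\<alpha>(F)\<close>
  (\<open>derived_iter_descent_family_ge\<close>).

  The map \<open>j\<close> is built along the members of \<open>F\<close>. To \<open>E\<close> of height \<open>\<rho>\<close> belongs a node
  above which the ambient tree still contains a copy of \<open>MT (\<zeta>\<rho>)\<close>; for the empty set this
  node is the root. If \<open>G\<close> extends \<open>E\<close> by the single integer \<open>m\<close>, its height \<open>\<rho>'\<close> is below
  \<open>\<rho>\<close>, so \<open>\<zeta>\<rho>' + \<zeta> \<le> \<zeta>\<rho>\<close>, and \<open>MT (\<zeta>\<rho>' + \<zeta>)\<close> contains a copy of \<open>\<T>\<^sub>\<zeta>\<close> with a
  copy of \<open>MT (\<zeta>\<rho>')\<close> left above each of its nodes. The hypothesis on infima, applied to that copy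
  of \<open>\<T>\<^sub>\<zeta>\<close> and to \<open>f\<^sub>m\<close>, gives a segment on which \<open>f\<^sub>m\<close> is below \<open>\<epsilon>\<^sub>m\<close>. It
  becomes \<open>j G\<close>, and a node above it with room for \<open>MT (\<zeta>\<rho>')\<close> is the node of \<open>G\<close>
  (\<open>segment_step\<close>).
\<close>

section \<open>Ordinal arithmetic\<close>

text \<open>
  Countability enters here: an uncountable set need not be bounded, and then \<open>osup\<close> is
  meaningless.
\<close>

lemma osup_upper:
  assumes "countable A" "a \<in> A"
  shows "a \<le> osup A"
proof -
  obtain u where "\<forall>a\<in>A. a < u" using countable_bounded_cord[OF assms(1)] by blast
  then have "\<forall>a\<in>A. a \<le> u" by auto
  then have "\<forall>a\<in>A. a \<le> osup A" unfolding osup_def by (rule LeastI)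
  then show ?thesis using assms(2) by blast
qed

lemma osup_least: "(\<And>a. a \<in> A \<Longrightarrow> a \<le> u) \<Longrightarrow> osup A \<le> u"
  unfolding osup_def by (rule Least_le) blast

lemma add_less_add_cord: "\<beta> < \<gamma> \<Longrightarrow> \<alpha> + \<beta> < \<alpha> + (\<gamma>::cord)"
proof (induction \<gamma> rule: less_induct)
  case (less \<gamma>)
  show ?case
  proof (cases \<gamma> rule: cord_cases)
    case zero
    then show ?thesis using less.prems by simp
  next
    case (osuc \<gamma>')
    then have "\<beta> < \<gamma>' \<or> \<beta> = \<gamma>'" using less.prems by (auto simp: less_osuc_iff)
    then have "\<alpha> + \<beta> \<le> \<alpha> + \<gamma>'" using less.IH[of \<gamma>'] osuc by auto
    then show ?thesis using osuc by (simp add: add_osuc_cord less_osuc_iff)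
  next
    case olim
    have "\<alpha> + \<beta> < \<alpha> + osuc \<beta>" by (simp add: add_osuc_cord)
    also have "\<dots> \<le> \<alpha> + \<gamma>"
      unfolding add_olim_cord[OF olim]
      using osuc_less_olim[OF olim less.prems]
      by (intro osup_upper countable_image countable_lessThan_cord) auto
    finally show ?thesis .
  qed
qed

lemma le_add_cord: "\<alpha> \<le> \<alpha> + (\<beta>::cord)"
proof (cases "\<beta> = 0")
  case False
  then have "0 < \<beta>" using zero_le_cord[of \<beta>] by (simp add: order_less_le)
  then show ?thesis using add_less_add_cord[of 0 \<beta> \<alpha>] by (simp add: add_zero_cord)
qed (simp add: add_zero_cord)

lemma is_olim_add: "is_olim \<beta> \<Longrightarrow> is_olim (\<alpha> + \<beta>)"
proof -
  assume lim: "is_olim \<beta>"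
  have "\<alpha> + \<beta> \<noteq> osuc \<delta>" for \<delta>
  proof
    assume eq: "\<alpha> + \<beta> = osuc \<delta>"
    have "\<alpha> + \<gamma> \<le> \<delta>" if "\<gamma> < \<beta>" for \<gamma>
      using add_less_add_cord[OF that, of \<alpha>] by (simp add: eq less_osuc_iff)
    then have "\<alpha> + \<beta> \<le> \<delta>"
      unfolding add_olim_cord[OF lim] by (intro osup_least) auto
    then show False using eq less_osuc[of \<delta>] by (metis not_le)
  qed
  moreover have "\<alpha> + \<beta> \<noteq> 0"
    using add_less_add_cord[of 0 \<beta> \<alpha>] is_olimD(1)[OF lim] zero_le_cord[of \<beta>]
    by (metis not_less_zero_cord order_less_le)
  ultimately show ?thesis by (auto simp: is_olim_def is_osuc_def)
qed

text \<open>
  This inequality is why one step down in height pays for one copy of \<open>\<T>\<^sub>\<zeta>\<close>.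
\<close>

lemma mult_add_le_mult_cord: "\<rho> < \<xi> \<Longrightarrow> \<zeta> * \<rho> + \<zeta> \<le> \<zeta> * (\<xi>::cord)"
proof (induction \<xi> rule: less_induct)
  case (less \<xi>)
  show ?case
  proof (cases \<xi> rule: cord_cases)
    case zero
    then show ?thesis using less.prems by simp
  next
    case (osuc \<xi>')
    then have "\<rho> < \<xi>' \<or> \<rho> = \<xi>'" using less.prems by (auto simp: less_osuc_iff)
    then show ?thesis
    proof
      assume "\<rho> < \<xi>'"
      then have "\<zeta> * \<rho> + \<zeta> \<le> \<zeta> * \<xi>'" using less.IH[of \<xi>'] osuc by auto
      also have "\<dots> \<le> \<zeta> * \<xi>" using osuc by (simp add: mult_osuc_cord le_add_cord)
      finally show ?thesis .
    qed (use osuc in \<open>simp add: mult_osuc_cord\<close>)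
  next
    case olim
    have "\<zeta> * osuc \<rho> \<le> \<zeta> * \<xi>"
      unfolding mult_olim_cord[OF olim]
      using osuc_less_olim[OF olim less.prems]
      by (intro osup_upper countable_image countable_lessThan_cord) auto
    then show ?thesis by (simp add: mult_osuc_cord)
  qed
qed


section \<open>Copies of minimal trees inside larger ones\<close>

lemma Nil_in_MT: "[] \<in> MT \<beta>"
proof (cases \<beta> rule: cord_cases)
  case olim
  then have "0 < \<beta>" using zero_le_cord[of \<beta>] by (auto simp: order_less_le is_olim_def)
  then show ?thesis unfolding MT_olim[OF olim] by (auto simp: MT_osuc)
qed (auto simp: MT_zero MT_osuc)

lemma MT_prefix_closed: "t @ s \<in> MT \<beta> \<Longrightarrow> t \<in> MT \<beta>"
proof (induction \<beta> arbitrary: t rule: less_induct)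
  case (less \<beta>)
  show ?case
  proof (cases \<beta> rule: cord_cases)
    case zero
    then show ?thesis using less.prems by (simp add: MT_zero)
  next
    case (osuc \<beta>')
    show ?thesis
    proof (cases t)
      case (Cons x t')
      then show ?thesis using less.prems less.IH[of \<beta>' t'] osuc by (auto simp: MT_osuc)
    qed (simp add: Nil_in_MT)
  next
    case olim
    then show ?thesis using less.prems less.IH osuc_less_olim[OF olim]
      by (auto simp: MT_olim)
  qed
qed

text \<open>
  The smaller tree need not be a subset of the larger one, since the letters record ordinals; it
  reappears above a suitable node. At a successor one descends by the forced first letter, at a
  limit one jumps directly to the letter \<open>osuc \<alpha>\<close>.
\<close>

lemma MT_shift:
  assumes "\<alpha> \<le> \<gamma>"
  shows "\<exists>p. \<forall>s\<in>MT \<alpha>. p @ s \<in> MT \<gamma>"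
  using assms
proof (induction \<gamma> rule: less_induct)
  case (less \<gamma>)
  show ?case
  proof (cases "\<alpha> = \<gamma>")
    case True
    then show ?thesis by (intro exI[of _ "[]"]) simp
  next
    case False
    then have lt: "\<alpha> < \<gamma>" using less.prems by simp
    show ?thesis
    proof (cases \<gamma> rule: cord_cases)
      case zero
      then show ?thesis using lt by simp
    next
      case (osuc \<gamma>')
      then obtain p where "\<forall>s\<in>MT \<alpha>. p @ s \<in> MT \<gamma>'"
        using less.IH[of \<gamma>'] lt by (auto simp: less_osuc_iff)
      then show ?thesis by (intro exI[of _ "\<gamma> # p"]) (auto simp: osuc MT_osuc)
    next
      case olim
      then show ?thesis using lt
        by (intro exI[of _ "[osuc \<alpha>]"]) (auto simp: MT_olim MT_osuc)
    qed
  qed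
qed

text \<open>
  Adding \<open>\<alpha>\<close> on the left commutes with successors and preserves limits, so it maps \<open>MT \<beta>\<close>
  letterwise into \<open>MT (\<alpha> + \<beta>)\<close>. All letters of the image exceed \<open>\<alpha>\<close>, so a copy of
  \<open>MT \<alpha>\<close> remains above each node of the image.
\<close>

lemma MT_add:
  assumes "t \<in> MT \<beta>"
  shows "\<exists>p. \<forall>s\<in>MT \<alpha>. map ((+) \<alpha>) t @ p @ s \<in> MT (\<alpha> + \<beta>)"
  using assms
proof (induction \<beta> arbitrary: t rule: less_induct)
  case (less \<beta>)
  show ?case
  proof (cases "t = []")
    case True
    then show ?thesis using MT_shift[OF le_add_cord] by simp
  next
    case False
    show ?thesis
    proof (cases \<beta> rule: cord_cases)
      case zero
      then show ?thesis using False less.prems by (simp add: MT_zero)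
    next
      case (osuc \<beta>')
      then obtain t' where t': "t' \<in> MT \<beta>'" "t = osuc \<beta>' # t'"
        using False less.prems by (auto simp: MT_osuc)
      then obtain p where "\<forall>s\<in>MT \<alpha>. map ((+) \<alpha>) t' @ p @ s \<in> MT (\<alpha> + \<beta>')"
        using less.IH[of \<beta>' t'] osuc by auto
      then show ?thesis
        by (intro exI[of _ p]) (auto simp: osuc t' add_osuc_cord MT_osuc)
    next
      case olim
      then obtain \<eta> where \<eta>: "\<eta> < \<beta>" "t \<in> MT (osuc \<eta>)"
        using less.prems by (auto simp: MT_olim)
      then obtain p where "\<forall>s\<in>MT \<alpha>. map ((+) \<alpha>) t @ p @ s \<in> MT (osuc (\<alpha> + \<eta>))"
        using less.IH[of "osuc \<eta>" t] osuc_less_olim[OF olim] by (auto simp: add_osuc_cord)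
      then show ?thesis
        using add_less_add_cord[OF \<eta>(1), of \<alpha>]
        by (intro exI[of _ p]) (auto simp: MT_olim[OF is_olim_add[OF olim]])
    qed
  qed
qed

lemma \<T>_nonempty: "0 < \<beta> \<Longrightarrow> \<T> \<beta> \<noteq> {}"
proof -
  assume "0 < \<beta>"
  then have "osuc 0 \<le> \<beta>" by (simp add: osuc_le_iff)
  then obtain p where p: "\<forall>s\<in>MT (osuc 0). p @ s \<in> MT \<beta>" using MT_shift by blast
  have "[osuc 0] \<in> MT (osuc 0)" by (simp add: MT_osuc MT_zero)
  then show ?thesis using p by (force simp: \<T>_def)
qed

lemma segments_image:
  assumes op: "order_preserving strict_prefix strict_prefix U V i" and "[] \<notin> V"
    and c: "c \<in> segments U"
  shows "i ` c \<in> segments V"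
proof -
  have U: "c \<subseteq> U" and fin: "finite c" "c \<noteq> {}"
    and chain: "\<And>s t. s \<in> c \<Longrightarrow> t \<in> c \<Longrightarrow> s = t \<or> strict_prefix s t \<or> strict_prefix t s"
    using c by (auto simp: segments_def)
  have mono: "strict_prefix (i s) (i t)" if "s \<in> c" "t \<in> c" "strict_prefix s t" for s t
    using op that U unfolding order_preserving_def monotone_on_def by blast
  have "i s = i t \<or> strict_prefix (i s) (i t) \<or> strict_prefix (i t) (i s)"
    if "s \<in> c" "t \<in> c" for s t
    using chain[OF that] mono[OF that] mono[OF that(2,1)] by blast
  moreover have "i ` c \<subseteq> V - {[]}"
    using op U assms(2) unfolding order_preserving_def by (auto simp: Pi_iff)
  ultimately show ?thesis using fin by (simp add: segments_def)
qed

lemma segment_has_top: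
  assumes "c \<in> segments U"
  shows "\<exists>t\<in>c. \<forall>s\<in>c. prefix s t"
proof -
  have fin: "finite c" "c \<noteq> {}"
    and chain: "\<And>s t. s \<in> c \<Longrightarrow> t \<in> c \<Longrightarrow> s = t \<or> strict_prefix s t \<or> strict_prefix t s"
    using assms by (auto simp: segments_def)
  have "Max (length ` c) \<in> length ` c" using fin by (intro Max_in) auto
  then obtain t where "t \<in> c" "length t = Max (length ` c)" by auto
  then have t: "t \<in> c" "\<And>s. s \<in> c \<Longrightarrow> length s \<le> length t" using fin by auto
  have "prefix s t" if "s \<in> c" for s
    using chain[OF that t(1)] t(2)[OF that] prefix_length_less[of t s] by auto
  then show ?thesis using t(1) by blast
qed

text \<open>
  Think of \<open>u\<close> as the node reached so far, with a copy of \<open>MT \<beta>\<close> above it. Part \<open>\<zeta>\<close> of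
  \<open>\<beta>\<close> is spent on a copy of \<open>\<T>\<^sub>\<zeta>\<close>, in which a good segment is found, and part \<open>\<alpha>\<close> is
  kept for later: the next node \<open>v\<close> lies weakly above the segment, and \<open>MT \<alpha>\<close> still fits above
  \<open>v\<close>. The number \<open>\<delta>\<close> is beaten strictly because the infimum is \<open>0\<close>, over a set that is
  nonempty since \<open>0 < \<zeta>\<close>.
\<close>

lemma segment_step:
  assumes "0 < \<zeta>" "0 < \<delta>"
    and inf_zero: "\<And>i. order_preserving strict_prefix strict_prefix (\<T> \<zeta>) (\<T> \<kappa>) i \<Longrightarrow>
      bdd_below ((\<lambda>c. \<phi> (i ` c)) ` segments (\<T> \<zeta>)) \<and>
      (INF c\<in>segments (\<T> \<zeta>). \<phi> (i ` c)) = (0::real)"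
    and room: "\<forall>s\<in>MT \<beta>. u @ s \<in> MT \<kappa>"
    and le: "\<alpha> + \<zeta> \<le> \<beta>"
  shows "\<exists>c\<in>segments (\<T> \<kappa>). \<phi> c < \<delta> \<and> (\<forall>s\<in>c. strict_prefix u s) \<and>
    (\<exists>v. (\<forall>s\<in>c. prefix s v) \<and> (\<forall>s\<in>MT \<alpha>. v @ s \<in> MT \<kappa>))"
proof -
  obtain p where p: "\<forall>s\<in>MT (\<alpha> + \<zeta>). p @ s \<in> MT \<beta>" using MT_shift[OF le] by blast
  \<comment> \<open>\<open>p\<close> descends from \<open>u\<close> to a node above which the tree is at least \<open>MT (\<alpha> + \<zeta>)\<close>.\<close>
  define i where "i t = u @ p @ map ((+) \<alpha>) t" for t
  have ext: "\<exists>q. \<forall>s\<in>MT \<alpha>. i t @ q @ s \<in> MT \<kappa>" if t: "t \<in> MT \<zeta>" for t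
    using MT_add[OF t, of \<alpha>] p room unfolding i_def by (metis append.assoc)
  have closed: "i t \<in> MT \<kappa>" if t: "t \<in> MT \<zeta>" for t
    using ext[OF t] Nil_in_MT by (metis MT_prefix_closed)
  have mono: "strict_prefix (i s) (i t)" if "strict_prefix s t" for s t
    using that by (elim strict_prefixE') (simp add: i_def strict_prefix_def)
  have op: "order_preserving strict_prefix strict_prefix (\<T> \<zeta>) (\<T> \<kappa>) i"
    using mono closed by (auto simp: order_preserving_def monotone_on_def \<T>_def i_def)
  obtain t where "t \<in> \<T> \<zeta>" using \<T>_nonempty[OF assms(1)] by blast
  then have "{t} \<in> segments (\<T> \<zeta>)" by (auto simp: segments_def \<T>_def)
  then have "segments (\<T> \<zeta>) \<noteq> {}" by blast
  then obtain c where c: "c \<in> segments (\<T> \<zeta>)" "\<phi> (i ` c) < \<delta>"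
    using inf_zero[OF op] cINF_less_iff[of "segments (\<T> \<zeta>)" "\<lambda>c. \<phi> (i ` c)" \<delta>] assms(2)
    by auto
  have seg: "i ` c \<in> segments (\<T> \<kappa>)"
    by (rule segments_image[OF op _ c(1)]) (simp add: \<T>_def)
  have cT: "c \<subseteq> MT \<zeta> - {[]}" using c(1) by (auto simp: segments_def \<T>_def)
  obtain t where t: "t \<in> c" "\<forall>s\<in>i ` c. prefix s (i t)"
    using segment_has_top[OF seg] by auto
  obtain q where q: "\<forall>s\<in>MT \<alpha>. i t @ q @ s \<in> MT \<kappa>" using ext[of t] t(1) cT by auto
  show ?thesis
  proof (intro bexI[OF _ seg] conjI exI[of _ "i t @ q"])
    show "\<forall>s\<in>i ` c. strict_prefix u s"
      using cT by (auto simp: i_def strict_prefix_def)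
  qed (use c(2) t(2) q in auto)
qed


section \<open>A regular family of prescribed index\<close>

text \<open>
  Membership in an iterated derivative is like the recursion for the rank of a well-founded
  relation; zero, successors and limits need no separate treatment any more.
\<close>

lemma derived_iter_iff:
  "E \<in> derived_iter \<alpha> F \<longleftrightarrow> E \<in> F \<and> (\<forall>\<beta><\<alpha>. \<exists>G\<in>derived_iter \<beta> F. fin_less E G)"
proof (induction \<alpha> arbitrary: E rule: less_induct)
  case (less \<alpha>)
  show ?case
  proof (cases \<alpha> rule: cord_cases)
    case zero
    then show ?thesis by (simp add: derived_iter_zero)
  next
    case (osuc \<alpha>')
    have "E \<in> derived_iter \<alpha> F \<longleftrightarrow>
        E \<in> derived_iter \<alpha>' F \<and> (\<exists>G\<in>derived_iter \<alpha>' F. fin_less E G)"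
      by (auto simp: osuc derived_iter_osuc derived_def)
    then show ?thesis using less.IH[of \<alpha>' E]
      by (auto simp: osuc less_osuc_iff order_le_less)
  next
    case olim
    show ?thesis
    proof
      assume E: "E \<in> derived_iter \<alpha> F"
      have "\<exists>G\<in>derived_iter \<beta> F. fin_less E G" if "\<beta> < \<alpha>" for \<beta>
      proof -
        have "E \<in> derived_iter (osuc \<beta>) F"
          using E osuc_less_olim[OF olim that] by (simp add: derived_iter_olim[OF olim])
        then show ?thesis by (auto simp: derived_iter_osuc derived_def)
      qed
      moreover have "E \<in> F"
      proof -
        have "0 < \<alpha>" using olim zero_le_cord[of \<alpha>] by (auto simp: is_olim_def order_less_le)
        then have "E \<in> derived_iter 0 F" using E by (auto simp: derived_iter_olim[OF olim])
        then show ?thesis by (simp add: derived_iter_zero)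
      qed
      ultimately show "E \<in> F \<and> (\<forall>\<beta><\<alpha>. \<exists>G\<in>derived_iter \<beta> F. fin_less E G)" by blast
    next
      assume "E \<in> F \<and> (\<forall>\<beta><\<alpha>. \<exists>G\<in>derived_iter \<beta> F. fin_less E G)"
      then show "E \<in> derived_iter \<alpha> F"
        unfolding derived_iter_olim[OF olim]
        using less.IH order.strict_trans by blast
    qed
  qed
qed

text \<open>
  If \<open>r E < \<alpha>\<close>, then some \<open>G\<close> above \<open>E\<close> lies in the derivative of order \<open>r E\<close>; by
  induction \<open>r E \<le> r G\<close>, although \<open>r\<close> decreases.
\<close>

lemma derived_iter_le_rank:
  fixes r :: "nat set \<Rightarrow> cord"
  assumes dec: "\<And>E G. E \<in> F \<Longrightarrow> G \<in> F \<Longrightarrow> fin_less E G \<Longrightarrow> r G < r E"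
    and "E \<in> derived_iter \<alpha> F"
  shows "\<alpha> \<le> r E"
  using assms(2)
proof (induction \<alpha> arbitrary: E rule: less_induct)
  case (less \<alpha>)
  show ?case
  proof (rule ccontr)
    assume "\<not> \<alpha> \<le> r E"
    then have lt: "r E < \<alpha>" by simp
    then obtain G where G: "G \<in> derived_iter (r E) F" "fin_less E G"
      using less.prems derived_iter_iff by blast
    have "r E \<le> r G" using less.IH[OF lt G(1)] .
    moreover have "r G < r E" using dec G less.prems derived_iter_iff by blast
    ultimately show False by simp
  qed
qed

lemma fin_less_snoc:
  assumes "finite E" "\<And>m. m \<in> E \<Longrightarrow> m < n"
  shows "sorted_list_of_set (insert n E) = sorted_list_of_set E @ [n]"
    and "fin_less E (insert n E)"
proof -
  show eq: "sorted_list_of_set (insert n E) = sorted_list_of_set E @ [n]"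
    using assms
    by (intro strict_sorted_equal)
      (auto simp: sorted_wrt_append simp del: sorted_list_of_set.sorted_key_list_of_set_insert_remove)
  show "fin_less E (insert n E)" by (simp add: fin_less_def eq strict_prefix_def)
qed

lemma fin_lessD:
  assumes "finite E" "finite G" "fin_less E G"
  shows "E \<subseteq> G" "G \<noteq> {}" "E \<noteq> {} \<Longrightarrow> Max E < Max G"
proof -
  obtain zs where zs: "sorted_list_of_set G = sorted_list_of_set E @ zs" "zs \<noteq> []"
    using assms(3) by (auto simp: fin_less_def strict_prefix_def prefix_def)
  have set: "G = E \<union> set zs"
    using arg_cong[OF zs(1), of set] assms by simp
  have "sorted_wrt (<) (sorted_list_of_set E @ zs)"
    using strict_sorted_list_of_set[of G] zs(1) by simp
  then have lt: "\<forall>x\<in>E. \<forall>y\<in>set zs. x < y" using assms(1) by (simp add: sorted_wrt_append)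
  show "E \<subseteq> G" "G \<noteq> {}" using set zs(2) by auto
  assume "E \<noteq> {}"
  then have "Max E \<in> E" using assms(1) by simp
  moreover have "hd zs \<in> set zs" using zs(2) by simp
  ultimately have "Max E < hd zs" using lt by blast
  also have "\<dots> \<le> Max G" using assms(2) set zs(2) by (intro Max_ge) auto
  finally show "Max E < Max G" .
qed

definition labelling :: "(cord \<Rightarrow> nat) \<Rightarrow> cord \<Rightarrow> (nat \<Rightarrow> cord) \<Rightarrow> nat set \<Rightarrow> bool"
  where "labelling e \<xi> g E \<longleftrightarrow>
    (\<forall>n\<in>E. g n < \<xi> \<and> e (g n) \<le> n) \<and> (\<forall>m\<in>E. \<forall>n\<in>E. m < n \<longrightarrow> g n < g m)"

definition descent_family :: "(cord \<Rightarrow> nat) \<Rightarrow> cord \<Rightarrow> nat set set"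
  where "descent_family e \<xi> = {E. finite E \<and> (\<exists>g. labelling e \<xi> g E)}"

text \<open>
  The value \<open>\<xi>\<close> at the empty set makes the height decrease from the very first element on.
\<close>

definition height :: "(cord \<Rightarrow> nat) \<Rightarrow> cord \<Rightarrow> nat set \<Rightarrow> cord"
  where "height e \<xi> E = (if E = {} then \<xi> else Max {g (Max E) |g. labelling e \<xi> g E})"

lemma labelling_subset: "labelling e \<xi> g E \<Longrightarrow> G \<subseteq> E \<Longrightarrow> labelling e \<xi> g G"
  unfolding labelling_def by blast

lemma finite_labels_Max:
  assumes "inj_on e {..<\<xi>}" "finite E" "E \<noteq> {}"
  shows "finite {g (Max E) |g. labelling e \<xi> g E}"
proof -
  have "finite (e -` {..Max E} \<inter> {..<\<xi>})"
    using finite_vimage_IntI[OF _ assms(1)] by blast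
  moreover have "{g (Max E) |g. labelling e \<xi> g E} \<subseteq> e -` {..Max E} \<inter> {..<\<xi>}"
    using Max_in[OF assms(2,3)] by (auto simp: labelling_def)
  ultimately show ?thesis by (rule rev_finite_subset)
qed

lemma label_le_height:
  assumes "inj_on e {..<\<xi>}" "finite E" "E \<noteq> {}" "labelling e \<xi> g E"
  shows "g (Max E) \<le> height e \<xi> E"
  unfolding height_def using assms finite_labels_Max[OF assms(1-3)] by (auto intro: Max_ge)

lemma height_attained:
  assumes "inj_on e {..<\<xi>}" "E \<in> descent_family e \<xi>" "E \<noteq> {}"
  obtains g where "labelling e \<xi> g E" "height e \<xi> E = g (Max E)"
proof -
  have fin: "finite E" using assms(2) by (simp add: descent_family_def)
  have ne: "{g (Max E) |g. labelling e \<xi> g E} \<noteq> {}"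
    using assms(2) by (auto simp: descent_family_def)
  have "height e \<xi> E \<in> {g (Max E) |g. labelling e \<xi> g E}"
    unfolding height_def using assms(3) Max_in[OF finite_labels_Max[OF assms(1) fin assms(3)] ne] by simp
  then show thesis using that by blast
qed

lemma height_decreasing:
  assumes e: "inj_on e {..<\<xi>}"
    and E: "E \<in> descent_family e \<xi>" and G: "G \<in> descent_family e \<xi>" and less: "fin_less E G"
  shows "height e \<xi> G < height e \<xi> E"
proof -
  have fin: "finite E" "finite G" using E G by (auto simp: descent_family_def)
  note EG = fin_lessD[OF fin less]
  obtain g where g: "labelling e \<xi> g G" "height e \<xi> G = g (Max G)"
    using height_attained[OF e G EG(2)] .
  have mG: "Max G \<in> G" using fin(2) EG(2) by simp
  show ?thesis
  proof (cases "E = {}")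
    case True
    then show ?thesis using g mG by (simp add: height_def[of _ _ "{}"] labelling_def)
  next
    case False
    then have "Max E \<in> G" using EG(1) Max_in[OF fin(1)] by blast
    then have "g (Max G) < g (Max E)" using g(1) mG EG(3)[OF False] by (simp add: labelling_def)
    also have "\<dots> \<le> height e \<xi> E"
      by (rule label_le_height[OF e fin(1) False labelling_subset[OF g(1) EG(1)]])
    finally show ?thesis using g(2) by simp
  qed
qed

lemma hereditary_descent_family: "hereditary (descent_family e \<xi>)"
  unfolding hereditary_def descent_family_def
  using labelling_subset finite_subset by blast

text \<open>
  The labels are carried over along the order isomorphism between a set and its spread; the bounds
  \<open>e (g n) \<le> n\<close> survive since elements only grow.
\<close>

lemma spreading_descent_family: "spreading (descent_family e \<xi>)"
  unfolding spreading_def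
proof (intro ballI allI impI, elim conjE)
  fix E G assume E: "E \<in> descent_family e \<xi>" and G: "finite G" and spread: "is_spread_of G E"
  obtain g where g: "labelling e \<xi> g E" and finE: "finite E"
    using E by (auto simp: descent_family_def)
  define xs ys where "xs = sorted_list_of_set E" and "ys = sorted_list_of_set G"
  have sets: "set xs = E" "set ys = G" using finE G by (auto simp: xs_def ys_def)
  have sorted: "sorted_wrt (<) xs" "sorted_wrt (<) ys" by (auto simp: xs_def ys_def)
  have len: "length xs = length ys" and le: "\<And>k. k < length ys \<Longrightarrow> xs ! k \<le> ys ! k"
    using spread by (auto simp: is_spread_of_def xs_def ys_def list_all2_conv_all_nth)
  have dist: "distinct ys" by (simp add: ys_def)
  define h where "h n = g (xs ! (THE k. k < length ys \<and> ys ! k = n))" for n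
  have h: "h (ys ! k) = g (xs ! k)" if "k < length ys" for k
  proof -
    have "(THE k'. k' < length ys \<and> ys ! k' = ys ! k) = k"
      using that dist by (intro the_equality) (auto simp: nth_eq_iff_index_eq)
    then show ?thesis by (simp add: h_def)
  qed
  have "labelling e \<xi> h G"
    unfolding labelling_def
  proof (intro conjI ballI impI)
    fix n assume "n \<in> G"
    then obtain k where k: "k < length ys" "n = ys ! k" using sets by (auto simp: in_set_conv_nth)
    have "xs ! k \<in> E" using k len sets by auto
    then have "g (xs ! k) < \<xi>" "e (g (xs ! k)) \<le> xs ! k" using g by (auto simp: labelling_def)
    then show "h n < \<xi>" "e (h n) \<le> n" using h le[OF k(1)] k by auto
  next
    fix m n assume "m \<in> G" "n \<in> G" "m < n"
    then obtain k l where kl: "k < length ys" "m = ys ! k" "l < length ys" "n = ys ! l"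
      using sets by (metis in_set_conv_nth)
    have "k < l"
    proof (rule ccontr)
      assume "\<not> k < l"
      then have "ys ! l \<le> ys ! k"
        using sorted(2) kl by (metis le_eq_less_or_eq not_less sorted_wrt_nth_less)
      then show False using \<open>m < n\<close> kl by simp
    qed
    then have "xs ! k < xs ! l" using sorted(1) kl len by (simp add: sorted_wrt_nth_less)
    moreover have "xs ! k \<in> E" "xs ! l \<in> E" using kl len sets by auto
    ultimately show "h n < h m" using g h kl by (simp add: labelling_def)
  qed
  then show "G \<in> descent_family e \<xi>" using G by (auto simp: descent_family_def)
qed

text \<open>
  The heights of the initial segments of an infinite set would form an infinite descending sequence
  of ordinals. This well-foundedness is the substance of compactness.
\<close>

lemma descent_family_no_infinite_branch:
  assumes e: "inj_on e {..<\<xi>}" and N: "\<And>k. {n \<in> N. n < k} \<in> descent_family e \<xi>"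
  shows "finite N"
proof (rule ccontr)
  assume inf: "infinite N"
  define a where "a = enumerate N"
  have aN: "a k \<in> N" for k unfolding a_def by (rule enumerate_in_set[OF inf])
  have a_Suc: "n < a (Suc k) \<longleftrightarrow> n \<le> a k" if "n \<in> N" for n k
  proof
    assume "n < a (Suc k)"
    then have "\<not> (n \<in> N \<and> a k < n)"
      unfolding a_def enumerate_Suc''[OF inf] by (rule not_less_Least)
    then show "n \<le> a k" using that by simp
  next
    assume "n \<le> a k"
    then show "n < a (Suc k)"
      unfolding a_def using enumerate_step[OF inf, of k] by (rule order_le_less_trans)
  qed
  define H where "H k = {n \<in> N. n < a k}" for k
  have H: "H k \<in> descent_family e \<xi>" for k using N unfolding H_def .
  have less: "height e \<xi> (H (Suc k)) < height e \<xi> (H k)" for k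
  proof -
    have "H (Suc k) = insert (a k) (H k)"
    proof (rule set_eqI)
      fix n
      show "n \<in> H (Suc k) \<longleftrightarrow> n \<in> insert (a k) (H k)"
        using aN[of k] a_Suc[of n k] unfolding H_def le_less by blast
    qed
    moreover have "finite (H k)" using H[of k] by (simp add: descent_family_def)
    then have "fin_less (H k) (insert (a k) (H k))"
      by (rule fin_less_snoc(2)) (simp add: H_def)
    ultimately have "fin_less (H k) (H (Suc k))" by (simp only:)
    then show ?thesis by (rule height_decreasing[OF e H H])
  qed
  then have "\<exists>s. \<forall>k. (s (Suc k), s k) \<in> {(x::cord, y). x < y}"
    by (intro exI[of _ "\<lambda>k. height e \<xi> (H k)"]) simp
  moreover have "\<not> (\<exists>s. \<forall>k. (s (Suc k), s k) \<in> {(x::cord, y). x < y})"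
    by (rule iffD1[OF wf_iff_no_infinite_down_chain]) (rule wf)
  ultimately show False by (rule notE[rotated])
qed

text \<open>
  A set all of whose truncations lie in the family is finite, hence equal to one of its truncations.
  So the family is cut out of the compact space \<open>2\<^sup>\<nat>\<close> by conditions on finitely many
  coordinates each.
\<close>

lemma compact_family_descent_family:
  assumes e: "inj_on e {..<\<xi>}"
  shows "compact_family (descent_family e \<xi>)"
proof -
  let ?F = "descent_family e \<xi>"
  let ?A = "(\<lambda>E n. n \<in> E) ` ?F"
  have eq: "?A = (\<Inter>k. {x. {n. x n \<and> n < k} \<in> ?F})"
  proof (intro equalityI subsetI)
    fix x assume "x \<in> ?A"
    then obtain E where E: "E \<in> ?F" "x = (\<lambda>n. n \<in> E)" by blast
    have "{n \<in> E. n < k} \<in> ?F" for k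
      using hereditary_descent_family[of e \<xi>] E(1) unfolding hereditary_def
      by (metis (no_types, lifting) mem_Collect_eq subsetI)
    then show "x \<in> (\<Inter>k. {x. {n. x n \<and> n < k} \<in> ?F})" using E(2) by simp
  next
    fix x assume x: "x \<in> (\<Inter>k. {x. {n. x n \<and> n < k} \<in> ?F})"
    then have "finite {n. x n}"
      by (intro descent_family_no_infinite_branch[OF e]) auto
    then obtain k where "\<forall>n\<in>{n. x n}. n < k" using finite_nat_set_iff_bounded by blast
    then have "{n. x n \<and> n < k} = {n. x n}" by auto
    then have "{n. x n} \<in> ?F" using x by (metis (mono_tags, lifting) INT_E UNIV_I mem_Collect_eq)
    then show "x \<in> ?A" by (intro image_eqI[of _ _ "{n. x n}"]) auto
  qed
  have "closed {x :: nat \<Rightarrow> bool. {n. x n \<and> n < k} \<in> ?F}" for k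
  proof -
    have "{x :: nat \<Rightarrow> bool. {n. x n \<and> n < k} \<in> ?F} =
        (\<Union>S\<in>?F \<inter> Pow {..<k}. \<Inter>n\<in>{..<k}. {x. x n = (n \<in> S)})"
    proof (intro equalityI subsetI)
      fix x assume "x \<in> {x. {n. x n \<and> n < k} \<in> ?F}"
      then show "x \<in> (\<Union>S\<in>?F \<inter> Pow {..<k}. \<Inter>n\<in>{..<k}. {x. x n = (n \<in> S)})"
        by (intro UN_I[of "{n. x n \<and> n < k}"]) auto
    next
      fix x assume "x \<in> (\<Union>S\<in>?F \<inter> Pow {..<k}. \<Inter>n\<in>{..<k}. {x. x n = (n \<in> S)})"
      then obtain S where S: "S \<in> ?F" "S \<subseteq> {..<k}" "\<forall>n<k. x n = (n \<in> S)" by auto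
      then have "{n. x n \<and> n < k} = S" by auto
      then show "x \<in> {x. {n. x n \<and> n < k} \<in> ?F}" using S by simp
    qed
    moreover have "closed {x :: nat \<Rightarrow> bool. x n = b}" for n b
      by (intro closed_Collect_eq continuous_intros continuous_on_product_coordinates)
    ultimately show ?thesis by (auto intro!: closed_UN closed_INT)
  qed
  then have "closed ?A" unfolding eq by (intro closed_INT) auto
  moreover have "compact (UNIV :: (nat \<Rightarrow> bool) set)"
  proof -
    have "compact_space (product_topology (\<lambda>_::nat. euclidean :: bool topology) UNIV)"
      by (intro compact_space_product_topology[THEN iffD2] disjI2)
        (auto simp: compact_space_def finite_imp_compact)
    then show ?thesis by (simp add: euclidean_product_topology compact_space_def)
  qed
  ultimately show ?thesis
    unfolding compact_family_def using closed_Int_compact[of ?A UNIV] by simp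
qed

lemma labelling_insert:
  assumes g: "labelling e \<xi> g E" and "\<beta> < \<xi>"
    and less: "\<And>m. m \<in> E \<Longrightarrow> \<beta> < g m"
    and n: "\<And>m. m \<in> E \<Longrightarrow> m < n" "e \<beta> \<le> n"
  shows "labelling e \<xi> (g(n := \<beta>)) (insert n E)"
proof -
  have "n \<notin> E" using n(1) by blast
  then show ?thesis
    using assms by (auto simp: labelling_def dest: less_asym)
qed

text \<open>
  For \<open>\<beta> < \<alpha>\<close>, append to \<open>E\<close> an integer that is both larger than \<open>Max E\<close> and at least
  \<open>e \<beta>\<close>, and label it \<open>\<beta>\<close>: by induction the result is in the derivative of order \<open>\<beta>\<close>.
\<close>

lemma derived_iter_descent_family_ge:
  assumes "labelling e \<xi> g E" "finite E" "E \<noteq> {}" "\<alpha> \<le> g (Max E)"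
  shows "E \<in> derived_iter \<alpha> (descent_family e \<xi>)"
  using assms
proof (induction \<alpha> arbitrary: E g rule: less_induct)
  case (less \<alpha>)
  note g = less.prems(1) and fin = less.prems(2) and ne = less.prems(3)
  have MaxE: "Max E \<in> E" using fin ne by simp
  have "\<exists>G\<in>derived_iter \<beta> (descent_family e \<xi>). fin_less E G" if \<beta>: "\<beta> < \<alpha>" for \<beta>
  proof -
    define n where "n = max (e \<beta>) (Suc (Max E))"
    have n: "m < n" if "m \<in> E" for m
      using Max_ge[OF fin that] by (simp add: n_def)
    have b: "\<beta> < g m" if "m \<in> E" for m
    proof -
      have "g (Max E) \<le> g m"
        using g MaxE that Max_ge[OF fin that] by (auto simp: labelling_def order_le_less)
      then show ?thesis using \<beta> less.prems(4) by simp
    qed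
    have "g (Max E) < \<xi>" using g MaxE by (simp add: labelling_def)
    then have "\<beta> < \<xi>" using b[OF MaxE] by simp
    then have "labelling e \<xi> (g(n := \<beta>)) (insert n E)"
      using labelling_insert[OF g _ b n] by (simp add: n_def)
    moreover have "Max (insert n E) = n"
      using n fin by (intro Max_eqI) (auto intro: less_imp_le)
    ultimately have "insert n E \<in> derived_iter \<beta> (descent_family e \<xi>)"
      using fin by (intro less.IH[OF \<beta>]) auto
    then show ?thesis using fin_less_snoc(2)[OF fin n] by blast
  qed
  moreover have "E \<in> descent_family e \<xi>" using g fin by (auto simp: descent_family_def)
  ultimately show ?case by (subst derived_iter_iff) blast
qed

lemma iota_descent_family:
  assumes e: "inj_on e {..<\<xi>}"
  shows "iota (descent_family e \<xi>) = \<xi>"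
  unfolding iota_def
proof (rule Least_equality)
  show "derived_iter \<xi> (descent_family e \<xi>) \<subseteq> {{}}"
  proof
    fix E assume E: "E \<in> derived_iter \<xi> (descent_family e \<xi>)"
    have "\<xi> \<le> height e \<xi> E"
      by (rule derived_iter_le_rank[OF height_decreasing[OF e] E])
    moreover have EF: "E \<in> descent_family e \<xi>" using E derived_iter_iff by blast
    have "height e \<xi> E < \<xi>" if ne: "E \<noteq> {}"
    proof -
      obtain g where "labelling e \<xi> g E" "height e \<xi> E = g (Max E)"
        using height_attained[OF e EF ne] .
      moreover have "Max E \<in> E" using ne EF by (simp add: descent_family_def)
      ultimately show ?thesis by (simp add: labelling_def)
    qed
    ultimately show "E \<in> {{}}" by fastforce
  qed
next
  fix \<alpha> assume sub: "derived_iter \<alpha> (descent_family e \<xi>) \<subseteq> {{}}"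
  show "\<xi> \<le> \<alpha>"
  proof (rule ccontr)
    assume "\<not> \<xi> \<le> \<alpha>"
    then have "labelling e \<xi> (\<lambda>_. \<alpha>) {e \<alpha>}" by (simp add: labelling_def)
    then have "{e \<alpha>} \<in> derived_iter \<alpha> (descent_family e \<xi>)"
      by (rule derived_iter_descent_family_ge) auto
    then show False using sub by blast
  qed
qed

lemma regular_descent_family:
  assumes "inj_on e {..<\<xi>}"
  shows "regular_family (descent_family e \<xi>)"
  using compact_family_descent_family[OF assms] spreading_descent_family hereditary_descent_family
  by (auto simp: regular_family_def descent_family_def)


section \<open>Assembling the segments\<close>

text \<open>
  Recursion along the sequence of immediate predecessors in the order \<open>\<prec>\<close> of finite sets, which
  is the order in which the segments have to be chosen.
\<close>

function max_rec :: "'b \<Rightarrow> (nat set \<Rightarrow> 'b \<Rightarrow> 'b) \<Rightarrow> nat set \<Rightarrow> 'b" where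
  "max_rec b h E = (if finite E \<and> E \<noteq> {} then h E (max_rec b h (E - {Max E})) else b)"
  by auto
termination
  by (relation "inv_image less_than (\<lambda>(b, h, E). card E)") (auto simp: card_gt_0_iff intro: card_Diff1_less)

declare max_rec.simps [simp del]

lemma max_rec_empty: "max_rec b h {} = b"
  and max_rec_nonempty:
    "finite E \<Longrightarrow> E \<noteq> {} \<Longrightarrow> max_rec b h E = h E (max_rec b h (E - {Max E}))"
  by (subst max_rec.simps, simp)+

text \<open>
  The set \<open>G - {Max G}\<close> is the immediate predecessor of \<open>G\<close>.
\<close>

lemma fin_less_remove_Max:
  assumes "finite G" "G \<noteq> {}"
  shows "fin_less (G - {Max G}) G"
    and "finite E \<Longrightarrow> fin_less E G \<Longrightarrow> E = G - {Max G} \<or> fin_less E (G - {Max G})"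
proof -
  have lt: "m < Max G" if "m \<in> G - {Max G}" for m
    using that assms Max_ge[OF assms(1), of m] by (auto simp: order_less_le)
  have ins: "insert (Max G) (G - {Max G}) = G" using Max_in[OF assms] by auto
  have eq: "sorted_list_of_set G = sorted_list_of_set (G - {Max G}) @ [Max G]"
    using fin_less_snoc(1)[of "G - {Max G}" "Max G", OF finite_Diff[OF assms(1)] lt]
    unfolding ins .
  show "fin_less (G - {Max G}) G" by (simp add: fin_less_def eq strict_prefix_def)
  assume E: "finite E" "fin_less E G"
  then have "prefix (sorted_list_of_set E) (sorted_list_of_set (G - {Max G}))"
    by (auto simp: fin_less_def eq strict_prefix_def prefix_snoc)
  moreover have "E = G - {Max G}"
    if "sorted_list_of_set E = sorted_list_of_set (G - {Max G})"
    using that E(1) assms(1) by (metis finite_Diff sorted_list_of_set.set_sorted_key_list_of_set)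
  ultimately show "E = G - {Max G} \<or> fin_less E (G - {Max G})"
    by (auto simp: fin_less_def strict_prefix_def)
qed

theorem lemma3p4:
  fixes \<zeta> \<xi> :: cord
    and f :: "nat \<Rightarrow> cord list set \<Rightarrow> real"
  assumes "0 < \<zeta>" and "0 < \<xi>"
    and incr: "\<And>c n. c \<in> segments (\<T> (\<zeta> * \<xi>)) \<Longrightarrow> f n c \<le> f (Suc n) c"
    and inf_zero: "\<And>i n. order_preserving strict_prefix strict_prefix (\<T> \<zeta>) (\<T> (\<zeta> * \<xi>)) i \<Longrightarrow>
      bdd_below ((\<lambda>c. f n (i ` c)) ` segments (\<T> \<zeta>)) \<and>
      (INF c\<in>segments (\<T> \<zeta>). f n (i ` c)) = 0"
  shows "\<forall>\<epsilon> :: nat \<Rightarrow> real. decseq \<epsilon> \<and> (\<forall>n. 0 < \<epsilon> n) \<and> \<epsilon> \<longlonglongrightarrow> 0 \<longrightarrow>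
    (\<exists>F j. regular_family F \<and> iota F = \<xi> \<and>
       order_preserving fin_less segment_less (F - {{}}) (segments (\<T> (\<zeta> * \<xi>))) j \<and>
       (\<forall>E\<in>F - {{}}. f (Max E) (j E) \<le> \<epsilon> (Max E)))"
proof (intro allI impI)
  fix \<epsilon> :: "nat \<Rightarrow> real"
  assume \<epsilon>: "decseq \<epsilon> \<and> (\<forall>n. 0 < \<epsilon> n) \<and> \<epsilon> \<longlonglongrightarrow> 0"
  let ?S = "segments (\<T> (\<zeta> * \<xi>))"
  define e where "e = to_nat_on {..<\<xi>}"
  have e: "inj_on e {..<\<xi>}" by (simp add: e_def countable_lessThan_cord inj_on_to_nat_on)
  define F where "F = descent_family e \<xi>"
  have fin: "finite E" if "E \<in> F" for E using that by (simp add: F_def descent_family_def)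
  have remove: "E - {Max E} \<in> F" if "E \<in> F" for E
    using that hereditary_descent_family unfolding F_def hereditary_def by blast
  \<comment> \<open>The invariant of the construction, for the node \<open>u\<close> of a set of height \<open>\<rho>\<close>.\<close>
  define room where "room \<rho> u \<longleftrightarrow> (\<forall>s\<in>MT (\<zeta> * \<rho>). u @ s \<in> MT (\<zeta> * \<xi>))" for \<rho> u
  define step where "step \<rho> \<rho>' u n c v \<longleftrightarrow> c \<in> ?S \<and> f n c < \<epsilon> n \<and>
      (\<forall>s\<in>c. strict_prefix u s \<and> prefix s v) \<and> room \<rho>' v" for \<rho> \<rho>' :: cord and u n c v
  have "\<exists>x. step \<rho> \<rho>' u n (fst x) (snd x)" if "room \<rho> u" "\<rho>' < \<rho>" for \<rho> \<rho>' u n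
  proof -
    have "0 < \<epsilon> n" using \<epsilon> by blast
    from segment_step[OF assms(1) this inf_zero that(1)[unfolded room_def]
        mult_add_le_mult_cord[OF that(2)], of n]
    obtain c v where "step \<rho> \<rho>' u n c v" unfolding step_def room_def by blast
    then show ?thesis by (intro exI[of _ "(c, v)"]) simp
  qed
  note step_some = someI_ex[OF this]
  \<comment> \<open>The segment and the next node come from one choice, since the node has to lie above
    that very segment; making them functions of the data lets the recursion iterate the step.\<close>
  define C V where "C \<rho> \<rho>' u n = fst (SOME x. step \<rho> \<rho>' u n (fst x) (snd x))"
    and "V \<rho> \<rho>' u n = snd (SOME x. step \<rho> \<rho>' u n (fst x) (snd x))" for \<rho> \<rho>' u n
  have "step \<rho> \<rho>' u n (C \<rho> \<rho>' u n) (V \<rho> \<rho>' u n)" if "room \<rho> u" "\<rho>' < \<rho>" for \<rho> \<rho>' u n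
    unfolding C_def V_def by (rule step_some[OF that])
  note CV = this[unfolded step_def]
  let ?r = "height e \<xi>"
  define K where "K = max_rec [] (\<lambda>E u. V (?r (E - {Max E})) (?r E) u (Max E))"
  define j where "j E = C (?r (E - {Max E})) (?r E) (K (E - {Max E})) (Max E)" for E
  have K: "K E = V (?r (E - {Max E})) (?r E) (K (E - {Max E})) (Max E)"
    if "finite E" "E \<noteq> {}" for E
    unfolding K_def by (rule max_rec_nonempty[OF that])
  have drop: "?r E < ?r (E - {Max E})" if "E \<in> F" "E \<noteq> {}" for E
    using remove[OF that(1)] that(1) fin_less_remove_Max(1)[OF fin[OF that(1)] that(2)]
    unfolding F_def by (rule height_decreasing[OF e])
  have room_K: "room (?r E) (K E)" if "E \<in> F" for E
    using fin[OF that] that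
  proof (induction E rule: finite_psubset_induct)
    case (psubset E)
    show ?case
    proof (cases "E = {}")
      case True
      have "room (?r {}) (K {})" unfolding room_def height_def K_def max_rec_empty by simp
      then show ?thesis unfolding True .
    next
      case False
      then have "E - {Max E} \<subset> E" using Max_in[OF psubset.hyps] by blast
      then have "room (?r (E - {Max E})) (K (E - {Max E}))"
        by (rule psubset.IH[OF _ remove[OF psubset.prems]])
      from CV[OF this drop[OF psubset.prems False], of "Max E"] show ?thesis
        unfolding K[OF psubset.hyps False] by blast
    qed
  qed
  have j: "j E \<in> ?S \<and> f (Max E) (j E) < \<epsilon> (Max E) \<and>
      (\<forall>s\<in>j E. strict_prefix (K (E - {Max E})) s \<and> prefix s (K E))"
    if "E \<in> F" "E \<noteq> {}" for E
    using CV[OF room_K[OF remove[OF that(1)]] drop[OF that], of "Max E"]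
    unfolding j_def K[OF fin[OF that(1)] that(2)] by blast
  have prefix_K: "prefix (K (E - {Max E})) (K E)" if E: "E \<in> F" "E \<noteq> {}" for E
  proof -
    have "j E \<noteq> {}" using j[OF E] by (simp add: segments_def)
    then obtain s where "s \<in> j E" by blast
    then show ?thesis using j[OF E] by (meson prefix_order.less_imp_le prefix_order.trans)
  qed
  have mono_K: "prefix (K E) (K G)" if "E \<in> F" "G \<in> F" "fin_less E G" for E G
    using fin[OF that(2)] that(2,3)
  proof (induction G rule: finite_psubset_induct)
    case (psubset G)
    have ne: "G \<noteq> {}" by (rule fin_lessD(2)[OF fin[OF that(1)] psubset.hyps psubset.prems(2)])
    have sub: "G - {Max G} \<subset> G" using Max_in[OF psubset.hyps ne] by blast
    have "prefix (K E) (K (G - {Max G}))"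
      using fin_less_remove_Max(2)[OF psubset.hyps ne fin[OF that(1)] psubset.prems(2)]
        psubset.IH[OF sub remove[OF psubset.prems(1)]] by auto
    then show ?case using prefix_K[OF psubset.prems(1) ne] by (rule prefix_order.trans)
  qed
  \<comment> \<open>The node of \<open>G - {Max G}\<close> lies weakly above \<open>j E\<close> and strictly below \<open>j G\<close>.\<close>
  have mono_j: "segment_less (j E) (j G)"
    if E: "E \<in> F" "E \<noteq> {}" and G: "G \<in> F" "G \<noteq> {}" and less: "fin_less E G" for E G
  proof -
    have "prefix (K E) (K (G - {Max G}))"
      using fin_less_remove_Max(2)[OF fin[OF G(1)] G(2) fin[OF E(1)] less]
        mono_K[OF E(1) remove[OF G(1)]] by auto
    then show ?thesis
      unfolding segment_less_def using j[OF E] j[OF G]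
      by (meson prefix_order.le_less_trans)
  qed
  show "\<exists>F j. regular_family F \<and> iota F = \<xi> \<and>
       order_preserving fin_less segment_less (F - {{}}) ?S j \<and>
       (\<forall>E\<in>F - {{}}. f (Max E) (j E) \<le> \<epsilon> (Max E))"
  proof (intro exI[of _ F] exI[of _ j] conjI)
    show "regular_family F" "iota F = \<xi>"
      unfolding F_def using regular_descent_family[OF e] iota_descent_family[OF e] by auto
    show "order_preserving fin_less segment_less (F - {{}}) ?S j"
      unfolding order_preserving_def monotone_on_def using j mono_j by blast
    show "\<forall>E\<in>F - {{}}. f (Max E) (j E) \<le> \<epsilon> (Max E)"
      using j by (auto intro: less_imp_le)
  qed
qed

end
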